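(* Assume the continuum hypothesis ($|\mathbb{R}|=\aleph_1$). Then there is a function $f:\mathbb{R}\to\omega$ such that for every $x\in\mathbb{R}$ the set $S_x=\{h>0: f(x-h)=f(x+h)\}$ has at most one element.
   Context: $\omega$ denotes the set of natural numbers. *)

theory Defs
  imports Complex_Main
begin

unbundle cardinal_syntax

end

theory Submission
  imports Defs "HOL-Library.Countable_Set_Type"
begin

text \<open>
  It suffices that every real is the sum of at most one unordered pair of distinct points of the
  same colour. Under CH the reals are the union of an increasing continuous chain of countable
  additive subgroups, and the colouring is extended along this chain, injectively on every
  difference \<open>K - H\<close> of consecutive members. Two pairs with the same sum, monochromatic and
  containing a point of \<open>K - H\<close>, then consist of \<open>a, c \<in> K - H\<close> and \<open>b, d \<in> H\<close> with
  \<open>c - a = b - d \<in> H\<close>. So the colours of \<open>(a, a + v)\<close>, with \<open>v = c - a\<close>, must not be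
  the reversed colours of a pair \<open>(d, d + v)\<close> in \<open>H\<close>. To ensure this, for each \<open>v\<close> an
  asymmetric relation of colours permitted for such later pairs is fixed as soon as \<open>v\<close> enters the
  chain, generic enough that any finitely many constraints with distinct known colours can be met by
  infinitely many new colours.
\<close>

section \<open>Greedy choice along an enumeration of a countable set\<close>

text \<open>Values are chosen in the order of an enumeration of \<open>X\<close>, so each choice
  faces only finitely many earlier values, all distinct. \<open>R\<close> is secured only from the
  earlier to the later element, whence the disjunction in the conclusion.\<close>

lemma greedy_choice:
  fixes X :: "'x set"
  assumes X: "countable X"
    and step: "\<And>x Y g. x \<in> X \<Longrightarrow> finite Y \<Longrightarrow> Y \<subseteq> X \<Longrightarrow> x \<notin> Y \<Longrightarrow> inj_on g Y \<Longrightarrow>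
      \<exists>n::'n. U x n \<and> (\<forall>y\<in>Y. n \<noteq> g y \<and> R y (g y) x n)"
  shows "\<exists>g. inj_on g X \<and> (\<forall>x\<in>X. U x (g x)) \<and>
    (\<forall>x\<in>X. \<forall>y\<in>X. x \<noteq> y \<longrightarrow> R x (g x) y (g y) \<or> R y (g y) x (g x))"
proof -
  define e where "e = to_nat_on X"
  have e: "inj_on e X" using X unfolding e_def by (rule inj_on_to_nat_on)
  define prior where "prior x = {y \<in> X. e y < e x}" for x
  define Q where "Q g x n \<longleftrightarrow>
    (x \<in> X \<longrightarrow> U x n \<and> (\<forall>y\<in>prior x. n \<noteq> g y \<and> R y (g y) x n))" for g x n
  have "\<exists>g. \<forall>x. Q g x (g x)"
  proof (rule dependent_wf_choice[of "measure e"])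
    show "Q f x r = Q g x r" if "\<And>z. (z, x) \<in> measure e \<Longrightarrow> f z = g z" for f g x r
    proof -
      have "f z = g z" if "z \<in> prior x" for z
        using that \<open>\<And>z. (z, x) \<in> measure e \<Longrightarrow> f z = g z\<close> by (simp add: prior_def)
      then show ?thesis by (simp add: Q_def)
    qed
    show "\<exists>n. Q g x n" if IH: "\<And>y. (y, x) \<in> measure e \<Longrightarrow> Q g y (g y)" for x g
    proof (cases "x \<in> X")
      case True
      have fin: "finite (prior x)"
      proof (rule finite_imageD)
        show "finite (e ` prior x)"
          by (rule finite_subset[of _ "{..<e x}"]) (auto simp: prior_def)
        show "inj_on e (prior x)"
          using e by (rule inj_on_subset) (auto simp: prior_def)
      qed
      have neq: "g y \<noteq> g z" if "y \<in> prior x" "z \<in> prior x" "e y < e z" for y z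
      proof -
        have "Q g z (g z)" using IH that by (simp add: prior_def)
        then show ?thesis using that by (auto simp: Q_def prior_def)
      qed
      \<comment> \<open>Of two earlier elements the later one was chosen to avoid the value of the
        other; this provides the injectivity that \<open>step\<close> demands.\<close>
      have "inj_on g (prior x)"
      proof (rule inj_onI, rule ccontr)
        fix y z assume yz: "y \<in> prior x" "z \<in> prior x" "g y = g z" "y \<noteq> z"
        then have "e y \<noteq> e z" using e by (auto simp: prior_def inj_on_def)
        then show False using neq yz by (metis linorder_neqE_nat)
      qed
      with step[OF True fin] show ?thesis
        by (auto simp: Q_def prior_def)
    qed (simp add: Q_def)
  qed simp
  then obtain g where g: "\<And>x. Q g x (g x)" by blast
  have later: "g y \<noteq> g x \<and> R x (g x) y (g y)" if "x \<in> X" "y \<in> X" "e x < e y" for x y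
    using g[of y] that by (auto simp: Q_def prior_def)
  have tot: "e x < e y \<or> e y < e x" if "x \<in> X" "y \<in> X" "x \<noteq> y" for x y
    using e that by (metis inj_on_def linorder_neqE_nat)
  have "inj_on g X"
    using later tot by (metis inj_onI)
  moreover have "\<forall>x\<in>X. U x (g x)" using g by (simp add: Q_def)
  moreover have "\<forall>x\<in>X. \<forall>y\<in>X. x \<noteq> y \<longrightarrow> R x (g x) y (g y) \<or> R y (g y) x (g x)"
    using later tot by metis
  ultimately show ?thesis by blast
qed

section \<open>Permitted colour pairs and good partial colourings\<close>

text \<open>The empty set qualifies too: it arises as the union of the empty chain in the
  application of Zorn's lemma.\<close>

definition add_closed :: "real set \<Rightarrow> bool" where
  "add_closed H \<longleftrightarrow> (\<forall>x\<in>H. \<forall>y\<in>H. x + y \<in> H) \<and> (\<forall>x\<in>H. - x \<in> H)"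

lemma add_closedD:
  assumes "add_closed H" "x \<in> H" "y \<in> H"
  shows "x + y \<in> H" "x - y \<in> H" "- x \<in> H"
proof -
  show "x + y \<in> H" "- x \<in> H" using assms by (auto simp: add_closed_def)
  have "x + - y \<in> H" using assms unfolding add_closed_def by blast
  then show "x - y \<in> H" by simp
qed

text \<open>An entry \<open>(w, k)\<close> of \<open>T\<close> is to be read as a point
  \<open>x - w\<close> of colour \<open>k\<close>, seen from the point \<open>x\<close> that is
  about to be coloured.\<close>

definition common :: "(real \<times> nat \<times> nat) set \<Rightarrow> (real \<times> nat) set \<Rightarrow> nat set" where
  "common E T = {n. \<forall>(w, k)\<in>T. (w, k, n) \<in> E}"

text \<open>Distinct colours keep \<open>(w, k)\<close> and \<open>(- w, k)\<close> from occurring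
  together. A common colour \<open>n\<close> for these two would permit \<open>(w, k, n)\<close>
  and, by passing to the converse, \<open>(w, n, k)\<close>, against asymmetry.\<close>

definition patterns :: "real set \<Rightarrow> (real \<times> nat) set set" where
  "patterns H = {T. finite T \<and> T \<subseteq> (H - {0}) \<times> UNIV \<and> inj_on snd T}"

lemma common_mono: "E \<subseteq> E' \<Longrightarrow> common E T \<subseteq> common E' T"
  by (auto simp: common_def)

lemma patternsD: "T \<in> patterns H \<Longrightarrow> finite T" "T \<in> patterns H \<Longrightarrow> fst ` T \<subseteq> H"
  by (auto simp: patterns_def)

lemma patterns_subset: "T \<in> patterns H \<Longrightarrow> fst ` T \<subseteq> H' \<Longrightarrow> T \<in> patterns H'"
  by (force simp: patterns_def)

lemma countable_patterns:
  assumes "countable H"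
  shows "countable (patterns H)"
proof (rule countable_subset)
  show "patterns H \<subseteq> {T. finite T \<and> T \<subseteq> (H - {0}) \<times> UNIV}"
    by (auto simp: patterns_def)
  show "countable {T. finite T \<and> T \<subseteq> (H - {0}) \<times> (UNIV :: nat set)}"
    using assms by (intro countable_Collect_finite_subset countable_SIGMA) auto
qed

text \<open>A triple \<open>(v, i, j) \<in> E\<close> permits points \<open>x\<close> and \<open>x + v\<close> that enter later, outside \<open>H\<close>, to
  receive the colours \<open>i\<close> and \<open>j\<close>.\<close>

definition good :: "real set \<Rightarrow> (real \<Rightarrow> nat) \<Rightarrow> (real \<times> nat \<times> nat) set \<Rightarrow> bool" where
  "good H f E \<longleftrightarrow> add_closed H
   \<and> (\<forall>a\<in>H. \<forall>b\<in>H. \<forall>c\<in>H. \<forall>d\<in>H. a \<noteq> b \<and> c \<noteq> d \<and> f a = f b \<and> f c = f d \<and> a + b = c + d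
        \<longrightarrow> a = c \<or> a = d)
   \<and> (\<forall>v i j. (v, i, j) \<in> E \<longrightarrow> v \<in> H \<and> (- v, j, i) \<in> E \<and> (v, j, i) \<notin> E)
   \<and> (\<forall>v i j b. (v, i, j) \<in> E \<and> b \<in> H \<and> b + v \<in> H \<longrightarrow> \<not> (f b = j \<and> f (b + v) = i))
   \<and> (\<forall>T\<in>patterns H. infinite (common E T))"

lemma goodD:
  assumes "good H f E"
  shows good_closed: "add_closed H"
    and good_pairs: "\<And>a b c d. \<lbrakk>a \<in> H; b \<in> H; c \<in> H; d \<in> H; a \<noteq> b; c \<noteq> d; f a = f b; f c = f d;
      a + b = c + d\<rbrakk> \<Longrightarrow> a = c \<or> a = d"
    and good_carrier: "\<And>v i j. (v, i, j) \<in> E \<Longrightarrow> v \<in> H"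
    and good_converse: "\<And>v i j. (v, i, j) \<in> E \<Longrightarrow> (- v, j, i) \<in> E"
    and good_asym: "\<And>v i j. (v, i, j) \<in> E \<Longrightarrow> (v, j, i) \<notin> E"
    and good_avoid: "\<And>v i j b. (v, i, j) \<in> E \<Longrightarrow> b \<in> H \<Longrightarrow> b + v \<in> H \<Longrightarrow> f b = j \<Longrightarrow>
      f (b + v) = i \<Longrightarrow> False"
    and good_infinite: "\<And>T. T \<in> patterns H \<Longrightarrow> infinite (common E T)"
  using assms by (simp_all add: good_def)

section \<open>Extension of a good colouring to a larger countable group\<close>

lemma good_colour_new_points:
  assumes good: "good H f E" and L: "countable L" and H: "countable H"
  obtains c where "inj_on c L"
    "\<And>a a'. a \<in> L \<Longrightarrow> a' \<in> L \<Longrightarrow> a \<noteq> a' \<Longrightarrow> a' - a \<in> H \<Longrightarrow> (a' - a, c a, c a') \<in> E"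
    "\<And>T. T \<in> patterns H \<Longrightarrow> infinite (common E T - c ` L)"
proof -
  \<comment> \<open>\<open>Inl a\<close> asks for the colour of \<open>a\<close>;
    \<open>Inr (T, m)\<close> asks for the \<open>m\<close>-th colour reserved for \<open>T\<close>.
    Injectivity on the disjoint sum separates the two kinds.\<close>
  define X where "X = L <+> (patterns H \<times> (UNIV :: nat set))"
  define U where "U x n = (case x of Inl a \<Rightarrow> True | Inr (T, m) \<Rightarrow> n \<in> common E T)"
    for x :: "real + ((real \<times> nat) set \<times> nat)" and n
  define R where "R x n y n' = (\<forall>a a'. x = Inl a \<longrightarrow> y = Inl a' \<longrightarrow> a' - a \<in> H
      \<longrightarrow> (a' - a, n, n') \<in> E)"
    for x y :: "real + ((real \<times> nat) set \<times> nat)" and n n'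
  have "countable X"
    using L countable_patterns[OF H] by (simp add: X_def)
  moreover have "\<exists>n::nat. U x n \<and> (\<forall>y\<in>Y. n \<noteq> g y \<and> R y (g y) x n)"
    if x: "x \<in> X" and Y: "finite Y" "Y \<subseteq> X" "x \<notin> Y" "inj_on g Y" for x Y g
  proof (cases x)
    case (Inl a)
    define Z where "Z = {a'. Inl a' \<in> Y \<and> a - a' \<in> H}"
    \<comment> \<open>What \<open>a\<close> sees of the points of its coset coloured before
      it.\<close>
    define T where "T = (\<lambda>a'. (a - a', g (Inl a'))) ` Z"
    have "finite Z"
    proof (rule finite_imageD)
      show "finite ((Inl :: real \<Rightarrow> real + ((real \<times> nat) set \<times> nat)) ` Z)"
        by (rule finite_subset[OF _ Y(1)]) (auto simp: Z_def)
    qed simp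
    moreover have "inj_on snd T"
      using Y(4) by (auto simp: T_def Z_def inj_on_def)
    moreover have "T \<subseteq> (H - {0}) \<times> UNIV"
      using Y(3) Inl by (auto simp: T_def Z_def)
    ultimately have "T \<in> patterns H" by (simp add: patterns_def T_def)
    then have "infinite (common E T - g ` Y)"
      using good_infinite[OF good] Y(1) by (simp add: Diff_infinite_finite)
    then obtain n where n: "n \<in> common E T" "n \<notin> g ` Y"
      using infinite_imp_nonempty by blast
    have "(a - a', g (Inl a'), n) \<in> E" if "Inl a' \<in> Y" "a - a' \<in> H" for a'
      using n(1) that by (auto simp: common_def T_def Z_def)
    then show ?thesis using n(2) Inl by (auto simp: U_def R_def)
  next
    case (Inr t)
    obtain T m where t: "t = (T, m)" by fastforce
    have "T \<in> patterns H" using x Inr t by (auto simp: X_def)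
    then have "infinite (common E T - g ` Y)"
      using good_infinite[OF good] Y(1) by (simp add: Diff_infinite_finite)
    then obtain n where "n \<in> common E T" "n \<notin> g ` Y"
      using infinite_imp_nonempty by blast
    then show ?thesis using Inr t by (auto simp: U_def R_def)
  qed
  ultimately obtain g where g: "inj_on g X" "\<forall>x\<in>X. U x (g x)"
    "\<forall>x\<in>X. \<forall>y\<in>X. x \<noteq> y \<longrightarrow> R x (g x) y (g y) \<or> R y (g y) x (g x)"
    using greedy_choice[of X U R] by blast
  show thesis
  proof (rule that[of "g \<circ> Inl"])
    show "inj_on (g \<circ> Inl) L"
      using g(1) by (auto simp: inj_on_def X_def)
    show "(a' - a, (g \<circ> Inl) a, (g \<circ> Inl) a') \<in> E"
      if "a \<in> L" "a' \<in> L" "a \<noteq> a'" "a' - a \<in> H" for a a'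
    proof -
      \<comment> \<open>Whichever of the two points was coloured first, closure of \<open>E\<close>
        under converses yields the triple in the desired direction.\<close>
      have "R (Inl a) (g (Inl a)) (Inl a') (g (Inl a')) \<or> R (Inl a') (g (Inl a')) (Inl a) (g (Inl a))"
        using g(3)[rule_format, of "Inl a" "Inl a'"] that by (auto simp: X_def)
      moreover have "a - a' \<in> H"
        using add_closedD(3)[OF good_closed[OF good] that(4) that(4)] by simp
      moreover have "(a' - a, i, j) \<in> E" if "(a - a', j, i) \<in> E" for i j
        using good_converse[OF good that] by simp
      ultimately show ?thesis using that(4) by (auto simp: R_def)
    qed
    show "infinite (common E T - (g \<circ> Inl) ` L)" if T: "T \<in> patterns H" for T
    proof -
      let ?h = "\<lambda>m. g (Inr (T, m))"
      have inX: "Inr (T, m) \<in> X" for m using T by (auto simp: X_def)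
      have "inj ?h" using g(1) inX by (auto simp: inj_on_def)
      then have "infinite (range ?h)" by (rule range_inj_infinite)
      moreover have "?h m \<in> common E T" for m
        using g(2) inX[of m] by (auto simp: U_def)
      moreover have "?h m \<noteq> g (Inl a)" if "a \<in> L" for m a
        using g(1) inX[of m] that by (auto simp: inj_on_def X_def)
      ultimately show ?thesis
        by (elim infinite_super[rotated]) auto
    qed
  qed
qed

text \<open>Differences in \<open>K - H\<close> do not occur in \<open>E\<close>, so their permitted
  colours can be fixed now. Every pattern \<open>T\<close> over \<open>K\<close> receives infinitely
  many colours \<open>g (T, m)\<close>, distinct for distinct pairs, so that a new triple reveals
  the pattern it comes from.\<close>

lemma good_step:
  assumes good: "good H f E" and HK: "H \<subseteq> K" and K: "add_closed K" "countable K"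
  obtains f' E' where "good K f' E'" "\<And>x. x \<in> H \<Longrightarrow> f' x = f x" "E \<subseteq> E'"
proof -
  have H: "countable H" using HK K(2) by (rule countable_subset)
  note Hc = add_closedD[OF good_closed[OF good]]
  note Kc = add_closedD[OF K(1)]
  define L where "L = K - H"
  have "countable L" using K(2) by (simp add: L_def)
  then obtain c where c: "inj_on c L"
    and cE: "\<And>a a'. a \<in> L \<Longrightarrow> a' \<in> L \<Longrightarrow> a \<noteq> a' \<Longrightarrow> a' - a \<in> H \<Longrightarrow> (a' - a, c a, c a') \<in> E"
    and cinf: "\<And>T. T \<in> patterns H \<Longrightarrow> infinite (common E T - c ` L)"
    using good_colour_new_points[OF good _ H] by metis
  define f' where "f' x = (if x \<in> H then f x else c x)" for x
  define old where "old T = T \<inter> H \<times> UNIV" for T :: "(real \<times> nat) set"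
  \<comment> \<open>If \<open>a - v\<close> is in \<open>H\<close>, permitting
    \<open>(v, c a, f (a - v))\<close> would be violated at once by the points \<open>a - v\<close>
    and \<open>a\<close>.\<close>
  define excl where "excl T = {f (a - v) | a v. a \<in> L \<and> (v, c a) \<in> T}" for T
  define X where "X = patterns K \<times> (UNIV :: nat set)"
  define U where "U t n \<longleftrightarrow> n \<in> common E (old (fst t)) \<and> n \<notin> c ` L \<and> n \<notin> excl (fst t)
      \<and> (\<forall>k\<in>snd ` fst t. k < n)" for t :: "(real \<times> nat) set \<times> nat" and n
  have X: "countable X" using countable_patterns[OF K(2)] by (simp add: X_def)
  have candidate: "\<exists>n. U t n \<and> (\<forall>y\<in>Y. n \<noteq> g y \<and> True)"
    if t: "t \<in> X" and Y: "finite Y" for t Y and g :: "(real \<times> nat) set \<times> nat \<Rightarrow> nat"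
  proof -
    obtain T m where tT: "t = (T, m)" by fastforce
    have T: "T \<in> patterns K" using t tT by (simp add: X_def)
    then have finT: "finite T" by (simp add: patterns_def)
    have "old T \<in> patterns H"
      using T by (auto simp: patterns_def old_def intro: inj_on_subset)
    then have inf: "infinite (common E (old T) - c ` L)" by (rule cinf)
    \<comment> \<open>As \<open>c\<close> is injective on \<open>L\<close>, each entry of
      \<open>T\<close> excludes at most one colour.\<close>
    have "excl T \<subseteq> (\<lambda>(v, k). f (the_inv_into L c k - v)) ` T"
      using c by (force simp: excl_def the_inv_into_f_f)
    then have "finite (excl T)" using finT by (meson finite_imageI finite_subset)
    moreover have "finite {n. \<exists>k\<in>snd ` T. n \<le> k}"
      using finT by simp
    ultimately have "finite (excl T \<union> {n. \<exists>k\<in>snd ` T. n \<le> k} \<union> g ` Y)"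
      using Y by simp
    then have "infinite (common E (old T) - c ` L - (excl T \<union> {n. \<exists>k\<in>snd ` T. n \<le> k} \<union> g ` Y))"
      using inf by (rule Diff_infinite_finite)
    then obtain n where "n \<in> common E (old T) - c ` L - (excl T \<union> {n. \<exists>k\<in>snd ` T. n \<le> k} \<union> g ` Y)"
      by (metis ex_in_conv infinite_imp_nonempty)
    then have "n \<in> common E (old T)" "n \<notin> c ` L" "n \<notin> excl T" "\<forall>k\<in>snd ` T. k < n" "n \<notin> g ` Y"
      using not_le by auto
    then have "U t n \<and> (\<forall>y\<in>Y. n \<noteq> g y \<and> True)" using tT by (auto simp: U_def)
    then show ?thesis ..
  qed
  have "\<exists>g. inj_on g X \<and> (\<forall>t\<in>X. U t (g t)) \<and> (\<forall>t\<in>X. \<forall>t'\<in>X. t \<noteq> t' \<longrightarrow> True \<or> True)"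
    by (rule greedy_choice[where R = "\<lambda>_ _ _ _. True", OF X]) (rule candidate)
  then obtain g where g: "inj_on g X" "\<forall>t\<in>X. U t (g t)" by blast
  define N where "N = {(v, k, g (T, m)) | v k T m. T \<in> patterns K \<and> (v, k) \<in> T \<and> v \<notin> H}"
  define E' where "E' = E \<union> N \<union> {(v, i, j). (- v, j, i) \<in> N}"
  have N: "\<exists>T m. T \<in> patterns K \<and> (v, k) \<in> T \<and> n = g (T, m) \<and> k < n \<and> n \<notin> c ` L \<and> n \<notin> excl T
      \<and> v \<in> K \<and> v \<notin> H \<and> v \<noteq> 0" if "(v, k, n) \<in> N" for v k n
  proof -
    from that obtain T m where T: "T \<in> patterns K" "(v, k) \<in> T" "v \<notin> H" "n = g (T, m)"
      by (auto simp: N_def)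
    then have "U (T, m) n" using g(2) by (auto simp: X_def)
    moreover have "v \<in> K" "v \<noteq> 0" using T(1,2) by (auto simp: patterns_def)
    ultimately show ?thesis using T by (force simp: U_def)
  qed
  have N_asym: "(- v, k, n) \<notin> N" if "(v, k, n) \<in> N" for v k n
  proof
    assume "(- v, k, n) \<in> N"
    with N obtain T m where T: "T \<in> patterns K" "(- v, k) \<in> T" "n = g (T, m)" by blast
    from that N obtain T' m' where T': "T' \<in> patterns K" "(v, k) \<in> T'" "n = g (T', m')" "v \<noteq> 0"
      by blast
    \<comment> \<open>The colour \<open>n\<close> determines the pattern, which would then contain
      both \<open>(v, k)\<close> and \<open>(- v, k)\<close>.\<close>
    have "(T, m) = (T', m')"
      by (rule inj_onD[OF g(1)]) (use T T' in \<open>simp_all add: X_def\<close>)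
    then have "(v, k) \<in> T" using T'(2) by simp
    moreover have "inj_on snd T" using T(1) by (simp add: patterns_def)
    ultimately have "(- v, k) = (v, k)"
      using T(2) inj_onD[of snd T "(- v, k)" "(v, k)"] by simp
    then show False using T'(4) by simp
  qed
  have N_avoid: False if "(v, k, n) \<in> N" "b \<in> K" "b + v \<in> K" "f' b = n" "f' (b + v) = k" for v k n b
  proof -
    from N[OF that(1)] obtain T where T: "(v, k) \<in> T" "n \<notin> c ` L" "n \<notin> excl T" "v \<notin> H"
      by blast
    have b: "b \<in> H"
      using T(2) that(2,4) by (auto simp: f'_def L_def split: if_splits)
    have "b + v \<notin> H" using Hc(2)[of "b + v" b] b T(4) by auto
    then have "b + v \<in> L" "c (b + v) = k"
      using that(3,5) by (auto simp: L_def f'_def)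
    then have "f (b + v - v) \<in> excl T" using T(1) unfolding excl_def by blast
    then show False using T(3) that(4) b by (simp add: f'_def)
  qed
  have E'_cases: "(v, i, j) \<in> E \<and> v \<in> H \<or> (v, i, j) \<in> N \<and> v \<notin> H \<and> i < j
      \<or> (- v, j, i) \<in> N \<and> v \<notin> H \<and> j < i" if "(v, i, j) \<in> E'" for v i j
    using that N[of v i j] N[of "- v" j i] good_carrier[OF good] Hc(3) by (auto simp: E'_def)
  have "good K f' E'"
    unfolding good_def
  proof (intro conjI allI ballI impI)
    show "add_closed K" by (rule K(1))
  next
    fix a b c' d
    assume mem: "a \<in> K" "b \<in> K" "c' \<in> K" "d \<in> K"
      and "a \<noteq> b \<and> c' \<noteq> d \<and> f' a = f' b \<and> f' c' = f' d \<and> a + b = c' + d"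
    then have ne: "a \<noteq> b" "c' \<noteq> d" "f' a = f' b" "f' c' = f' d" "a + b = c' + d" by auto
    have inj: "x \<in> H \<or> y \<in> H" if "x \<in> K" "y \<in> K" "x \<noteq> y" "f' x = f' y" for x y
      using that c by (auto simp: f'_def L_def inj_on_def split: if_splits)
    \<comment> \<open>Otherwise \<open>x\<close> and \<open>z\<close> lie in one coset, so
      \<open>E\<close> permits their colours for the difference \<open>z - x\<close>; but
      \<open>w\<close> and \<open>y\<close> have this same difference and carry the reversed colours
      inside \<open>H\<close>.\<close>
    have mixed: "x = z" if "x \<in> K - H" "y \<in> H" "z \<in> K - H" "w \<in> H" "f' x = f' y" "f' z = f' w"
      "x + y = z + w" for x y z w
    proof (rule ccontr)
      assume "x \<noteq> z"
      have eq: "z - x = y - w" using that(7) by simp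
      have "y - w \<in> H" using Hc(2) that(2,4) .
      then have "z - x \<in> H" unfolding eq .
      then have "(z - x, c x, c z) \<in> E" using cE that \<open>x \<noteq> z\<close> by (simp add: L_def)
      moreover have "w + (z - x) = y" using eq by simp
      moreover have "f w = c z" "f y = c x" using that by (auto simp: f'_def)
      ultimately show False
        using good_avoid[OF good, of "z - x" "c x" "c z" w] that(2,4) by metis
    qed
    have closed: "y \<in> H" if "x \<in> H" "z \<in> H" "w \<in> H" "x + y = z + w" for x y z w
    proof -
      have "y = z + w - x" using that(4) by simp
      moreover have "z + w - x \<in> H" using Hc(2)[OF Hc(1)] that(1-3) by blast
      ultimately show ?thesis by simp
    qed
    have ab: "a \<in> H \<or> b \<in> H" and cd: "c' \<in> H \<or> d \<in> H"
      using inj mem ne by blast+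
    have eqs: "b + a = c' + d" "c' + d = a + b" "d + c' = a + b" using ne(5) by simp_all
    show "a = c' \<or> a = d"
    proof (cases "a \<in> H \<and> b \<in> H")
      case True
      then have "c' \<in> H" "d \<in> H" using cd closed eqs by blast+
      then show ?thesis
        using good_pairs[OF good, of a b c' d] True ne by (simp add: f'_def)
    next
      case False
      \<comment> \<open>Three of the four points in \<open>H\<close> would force the fourth into
        \<open>H\<close>.\<close>
      then have "\<not> (c' \<in> H \<and> d \<in> H)" using ab closed ne(5) eqs(1) by blast
      then have cd': "c' \<in> K - H \<and> d \<in> H \<or> d \<in> K - H \<and> c' \<in> H" using cd mem by blast
      have "a \<in> K - H \<and> b \<in> H \<or> b \<in> K - H \<and> a \<in> H" using False ab mem by blast
      then have "a = c' \<or> a = d \<or> b = c' \<or> b = d"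
        using cd' mixed[of a b c' d] mixed[of a b d c'] mixed[of b a c' d] mixed[of b a d c'] ne
        by (metis add.commute)
      then show ?thesis using ne(5) by force
    qed
  next
    fix v i j assume v: "(v, i, j) \<in> E'"
    show "v \<in> K"
      using E'_cases[OF v] HK N[of v i j] N[of "- v" j i] Kc(3)[of "- v"] by auto
    show "(- v, j, i) \<in> E'"
      using v good_converse[OF good] by (auto simp: E'_def)
    show "(v, j, i) \<notin> E'"
    proof
      assume "(v, j, i) \<in> E'"
      from E'_cases[OF v] E'_cases[OF this] show False
        using good_asym[OF good] N_asym[of v i j] N_asym[of v j i] by auto
    qed
  next
    fix v i j b
    assume "(v, i, j) \<in> E' \<and> b \<in> K \<and> b + v \<in> K"
    then have v: "(v, i, j) \<in> E'" "b \<in> K" "b + v \<in> K" by auto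
    show "\<not> (f' b = j \<and> f' (b + v) = i)"
    proof
      assume col: "f' b = j \<and> f' (b + v) = i"
      from E'_cases[OF v(1)] consider "(v, i, j) \<in> E" "v \<in> H" | "(v, i, j) \<in> N" | "(- v, j, i) \<in> N"
        by blast
      then show False
      proof cases
        case 1
        show False
        proof (cases "b \<in> H")
          case True
          then have "b + v \<in> H" using Hc(1) 1 by simp
          then show False using good_avoid[OF good 1(1) True] col True by (simp add: f'_def)
        next
          case False
          then have "b + v \<notin> H" using Hc(2)[of "b + v" v] 1(2) by auto
          \<comment> \<open>For difference \<open>0\<close> the converse of a triple is its
            reversal, which asymmetry forbids.\<close>
          moreover have "v \<noteq> 0" using good_asym[OF good 1(1)] good_converse[OF good 1(1)] by auto
          ultimately have "(v, j, i) \<in> E"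
            using cE[of b "b + v"] False v 1(2) col by (simp add: L_def f'_def)
          then show False using good_asym[OF good 1(1)] by simp
        qed
      next
        case 2
        then show False using N_avoid v col by blast
      next
        case 3
        then show False using N_avoid[OF 3, of "b + v"] v col by simp
      qed
    qed
  next
    fix T assume T: "T \<in> patterns K"
    have "g (T, m) \<in> common E' T" for m
    proof -
      have "U (T, m) (g (T, m))" using g(2) T by (simp add: X_def)
      then have "(w, k, g (T, m)) \<in> E" if "(w, k) \<in> T" "w \<in> H" for w k
        using that by (auto simp: U_def common_def old_def)
      moreover have "(w, k, g (T, m)) \<in> N" if "(w, k) \<in> T" "w \<notin> H" for w k
        using that T by (auto simp: N_def)
      ultimately show ?thesis by (auto simp: common_def E'_def)
    qed
    moreover have "inj (\<lambda>m. g (T, m))"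
      using g(1) T by (auto simp: inj_on_def X_def)
    ultimately show "infinite (common E' T)"
      by (meson image_subsetI infinite_super range_inj_infinite)
  qed
  then show thesis
    by (rule that) (auto simp: f'_def E'_def)
qed

section \<open>Generated groups and unions of chains\<close>

text \<open>The additive subgroup generated by \<open>S\<close>, parametrised by pairs of lists so
  that countability is inherited from \<open>S\<close>.\<close>

definition generated :: "real set \<Rightarrow> real set" where
  "generated S = {sum_list xs - sum_list ys | xs ys. xs \<in> lists S \<and> ys \<in> lists S}"

lemma add_closed_generated: "add_closed (generated S)"
  unfolding add_closed_def
proof (intro conjI ballI)
  fix x y assume "x \<in> generated S" "y \<in> generated S"
  then obtain xs ys xs' ys' where *: "x = sum_list xs - sum_list ys" "y = sum_list xs' - sum_list ys'"
    "xs \<in> lists S" "ys \<in> lists S" "xs' \<in> lists S" "ys' \<in> lists S" unfolding generated_def by blast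
  then have "x + y = sum_list (xs @ xs') - sum_list (ys @ ys')" by simp
  moreover have "xs @ xs' \<in> lists S" "ys @ ys' \<in> lists S" using * by auto
  ultimately show "x + y \<in> generated S" unfolding generated_def by blast
next
  fix x assume "x \<in> generated S"
  then obtain xs ys where *: "x = sum_list xs - sum_list ys" "xs \<in> lists S" "ys \<in> lists S"
    unfolding generated_def by blast
  then have "- x = sum_list ys - sum_list xs" by simp
  then show "- x \<in> generated S" using * unfolding generated_def by blast
qed

lemma generated_mono: "S \<subseteq> S' \<Longrightarrow> generated S \<subseteq> generated S'"
  unfolding generated_def using lists_mono by blast

lemma subset_generated: "S \<subseteq> generated S"
proof
  fix x assume "x \<in> S"
  then show "x \<in> generated S"
    unfolding generated_def by (intro CollectI exI[of _ "[x]"] exI[of _ "[]"]) simp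
qed

lemma countable_generated: "countable S \<Longrightarrow> countable (generated S)"
proof -
  assume "countable S"
  moreover have "generated S \<subseteq> (\<lambda>(xs, ys). sum_list xs - sum_list ys) ` (lists S \<times> lists S)"
    by (auto simp: generated_def)
  ultimately show ?thesis by (meson countable_SIGMA countable_image countable_lists countable_subset)
qed

text \<open>Apart from infinitude, which passes to larger relations, each clause of
  \<open>good\<close> concerns finitely many points and triples, and these already lie in a single
  member of the chain.\<close>

lemma good_Union_chain:
  fixes C :: "(real set \<times> (real \<Rightarrow> nat) \<times> (real \<times> nat \<times> nat) set) set"
  assumes good: "\<And>H f E. (H, f, E) \<in> C \<Longrightarrow> good H f E"
    and agree: "\<And>H f E x. (H, f, E) \<in> C \<Longrightarrow> x \<in> H \<Longrightarrow> F x = f x"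
    and chain: "\<And>H f E H' f' E'. (H, f, E) \<in> C \<Longrightarrow> (H', f', E') \<in> C \<Longrightarrow>
      H \<subseteq> H' \<and> E \<subseteq> E' \<or> H' \<subseteq> H \<and> E' \<subseteq> E"
  shows "good (\<Union>(H, f, E)\<in>C. H) F (\<Union>(H, f, E)\<in>C. E)"
proof -
  let ?H = "\<Union>(H, f, E)\<in>C. H" and ?E = "\<Union>(H, f, E)\<in>C. E"
  have cover: "\<exists>H f E. (H, f, E) \<in> C \<and> Z \<subseteq> H \<and> W \<subseteq> E"
    if "finite Z" "finite W" "Z \<subseteq> ?H" "W \<subseteq> ?E" "Z \<noteq> {} \<or> W \<noteq> {}" for Z W
  proof -
    \<comment> \<open>The disjoint sum lets one chain argument find a member that covers the points
      and the triples simultaneously.\<close>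
    define \<phi> where "\<phi> = (\<lambda>(H :: real set, f :: real \<Rightarrow> nat, E). H <+> (E :: (real \<times> nat \<times> nat) set))"
    have "finite (Z <+> W)" using that by simp
    moreover have "Z <+> W \<subseteq> \<Union>(\<phi> ` C)"
      using that(3,4) by (fastforce simp: \<phi>_def)
    moreover have "\<phi> ` C \<noteq> {}" using that by auto
    moreover have "subset.chain UNIV (\<phi> ` C)"
      unfolding subset_chain_def \<phi>_def using chain by fast
    ultimately obtain B where "B \<in> \<phi> ` C" "Z <+> W \<subseteq> B"
      by (rule finite_subset_Union_chain)
    then show ?thesis by (fastforce simp: \<phi>_def)
  qed
  show ?thesis
    unfolding good_def
  proof (intro conjI allI ballI impI)
    show "add_closed ?H"
      unfolding add_closed_def
    proof (intro conjI ballI)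
      fix x y assume "x \<in> ?H" "y \<in> ?H"
      then obtain H f E where C: "(H, f, E) \<in> C" "x \<in> H" "y \<in> H" using cover[of "{x, y}" "{}"] by auto
      then have "x + y \<in> H" using add_closedD(1)[OF good_closed[OF good]] by blast
      then show "x + y \<in> ?H" using C by blast
    next
      fix x assume "x \<in> ?H"
      then obtain H f E where C: "(H, f, E) \<in> C" "x \<in> H" by auto
      then have "- x \<in> H" using add_closedD(3)[OF good_closed[OF good]] by blast
      then show "- x \<in> ?H" using C by blast
    qed
  next
    fix a b c d
    assume "a \<in> ?H" "b \<in> ?H" "c \<in> ?H" "d \<in> ?H"
    then obtain H f E where C: "(H, f, E) \<in> C" "a \<in> H" "b \<in> H" "c \<in> H" "d \<in> H"
      using cover[of "{a, b, c, d}" "{}"] by auto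
    assume "a \<noteq> b \<and> c \<noteq> d \<and> F a = F b \<and> F c = F d \<and> a + b = c + d"
    then show "a = c \<or> a = d"
      using good_pairs[OF good[OF C(1)] C(2-5)] agree[OF C(1)] C(2-5) by simp
  next
    fix v i j assume v: "(v, i, j) \<in> ?E"
    then obtain H f E where C: "(H, f, E) \<in> C" "(v, i, j) \<in> E" by auto
    show "v \<in> ?H" using good_carrier[OF good[OF C(1)] C(2)] C(1) by blast
    show "(- v, j, i) \<in> ?E" using good_converse[OF good[OF C(1)] C(2)] C(1) by blast
    show "(v, j, i) \<notin> ?E"
    proof
      assume "(v, j, i) \<in> ?E"
      with v obtain H f E where C: "(H, f, E) \<in> C" "(v, i, j) \<in> E" "(v, j, i) \<in> E"
        using cover[of "{}" "{(v, i, j), (v, j, i)}"] by auto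
      then show False using good_asym[OF good[OF C(1)] C(2)] by simp
    qed
  next
    fix v i j b
    assume "(v, i, j) \<in> ?E \<and> b \<in> ?H \<and> b + v \<in> ?H"
    then obtain H f E where C: "(H, f, E) \<in> C" "(v, i, j) \<in> E" "b \<in> H" "b + v \<in> H"
      using cover[of "{b, b + v}" "{(v, i, j)}"] by auto
    then show "\<not> (F b = j \<and> F (b + v) = i)"
      using good_avoid[OF good[OF C(1)] C(2-4)] agree[OF C(1)] by auto
  next
    fix T assume T: "T \<in> patterns ?H"
    show "infinite (common ?E T)"
    \<comment> \<open>The chain may be empty, so the empty pattern is treated directly: it admits
      every colour.\<close>
    proof (cases "T = {}")
      case True
      then show ?thesis by (simp add: common_def)
    next
      case False
      have "finite (fst ` T)" "fst ` T \<subseteq> ?H" using patternsD[OF T] by simp_all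
      with False obtain H f E where C: "(H, f, E) \<in> C" "fst ` T \<subseteq> H"
        using cover[of "fst ` T" "{}"] by auto
      have "T \<in> patterns H" using T C(2) by (rule patterns_subset)
      then have "infinite (common E T)" using good_infinite[OF good[OF C(1)]] by blast
      moreover have "common E T \<subseteq> common ?E T" using C(1) by (intro common_mono) blast
      ultimately show ?thesis by (rule infinite_super[rotated])
    qed
  qed
qed

section \<open>Zorn's lemma and the continuum hypothesis\<close>

text \<open>Zorn's lemma replaces transfinite recursion along \<open>r\<close>. A maximal carrier
  \<open>H\<close> missing a point \<open>x\<close> lies inside the countable group generated by the
  segment up to \<open>x\<close>, and \<open>good_step\<close> extends it to that group.\<close>

lemma exists_good_UNIV:
  fixes r :: "real rel"
  assumes tot: "\<And>x y. (x, y) \<in> r \<or> (y, x) \<in> r" and tr: "trans r"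
    and seg: "\<And>x. countable {y. (y, x) \<in> r}"
  obtains f E where "good UNIV f E"
proof -
  define down where "down S \<longleftrightarrow> (\<forall>x\<in>S. \<forall>y. (y, x) \<in> r \<longrightarrow> y \<in> S)" for S
  \<comment> \<open>A union of a chain of such sets \<open>H\<close> is again such a set, and it is countable unless it is everything.\<close>
  define sandwich where "sandwich H \<longleftrightarrow> (\<exists>S. down S \<and> S \<subseteq> H \<and> H \<subseteq> generated S)" for H
  define A where "A = {(H, f, E). good H f E \<and> sandwich H \<and> (\<forall>x. x \<notin> H \<longrightarrow> f x = 0)}"
  define P where "P = (\<lambda>(H, f, E) (H', f', E').
    H \<subseteq> H' \<and> (E :: (real \<times> nat \<times> nat) set) \<subseteq> E' \<and> (\<forall>x\<in>H. (f :: real \<Rightarrow> nat) x = f' x))"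
  \<comment> \<open>The value \<open>0\<close> off \<open>H\<close> in \<open>A\<close> makes \<open>P\<close> antisymmetric.\<close>
  have "\<exists>m\<in>A. \<forall>a\<in>A. P m a \<longrightarrow> a = m"
  proof (rule predicate_Zorn)
    have "refl_on A (relation_of P A)"
      by (auto simp: refl_on_def relation_of_def P_def)
    moreover have "relation_of P A \<subseteq> A \<times> A" by (auto simp: relation_of_def)
    moreover have "trans (relation_of P A)"
      unfolding trans_def relation_of_def P_def by fastforce
    moreover have "antisym (relation_of P A)"
    proof (rule antisymI)
      fix s t assume st: "(s, t) \<in> relation_of P A" "(t, s) \<in> relation_of P A"
      obtain H f E H' f' E' where eq: "s = (H, f, E)" "t = (H', f', E')" by (metis prod_cases3)
      have "H = H'" "E = E'" using st eq by (auto simp: relation_of_def P_def)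
      moreover have "f x = f' x" for x
        using st eq \<open>H = H'\<close> by (cases "x \<in> H") (auto simp: relation_of_def P_def A_def)
      ultimately show "s = t" using eq by auto
    qed
    ultimately show "partial_order_on A (relation_of P A)"
      by (simp add: partial_order_on_def preorder_on_def)
  next
    fix C assume "C \<in> Chains (relation_of P A)"
    then have CA: "C \<subseteq> A" and chain: "\<And>s t. s \<in> C \<Longrightarrow> t \<in> C \<Longrightarrow> P s t \<or> P t s"
      by (auto simp: Chains_def relation_of_def)
    let ?H = "\<Union>(H, f, E)\<in>C. H" and ?E = "\<Union>(H, f, E)\<in>C. E"
    \<comment> \<open>Any member of the chain whose carrier contains \<open>x\<close> gives the same
      colour.\<close>
    define F where "F x = (if x \<in> ?H then fst (snd (SOME s. s \<in> C \<and> x \<in> fst s)) x else 0)" for x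
    have agree: "F x = f x" if "(H, f, E) \<in> C" "x \<in> H" for H f E x
    proof -
      define s where "s = (SOME s. s \<in> C \<and> x \<in> fst s)"
      have "s \<in> C \<and> x \<in> fst s"
        unfolding s_def by (rule someI[of _ "(H, f, E)"]) (use that in auto)
      moreover obtain H' f' E' where "s = (H', f', E')" by (metis prod_cases3)
      ultimately have "fst (snd s) x = f x"
        using chain[OF that(1), of s] that(2) by (auto simp: P_def)
      moreover have "x \<in> ?H" using that by blast
      ultimately show ?thesis unfolding F_def s_def by simp
    qed
    have "good ?H F ?E"
    proof (rule good_Union_chain)
      show "good H f E" if "(H, f, E) \<in> C" for H f E using that CA by (auto simp: A_def)
      show "F x = f x" if "(H, f, E) \<in> C" "x \<in> H" for H f E x using that by (rule agree)
      show "H \<subseteq> H' \<and> E \<subseteq> E' \<or> H' \<subseteq> H \<and> E' \<subseteq> E"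
        if "(H, f, E) \<in> C" "(H', f', E') \<in> C" for H f E H' f' E'
        using chain[OF that] by (auto simp: P_def)
    qed
    moreover have "sandwich ?H"
    proof -
      have "\<forall>s\<in>C. \<exists>S. down S \<and> S \<subseteq> fst s \<and> fst s \<subseteq> generated S"
        using CA by (auto simp: A_def sandwich_def)
      then obtain S where S: "\<And>s. s \<in> C \<Longrightarrow> down (S s) \<and> S s \<subseteq> fst s \<and> fst s \<subseteq> generated (S s)"
        by metis
      have "down (\<Union>s\<in>C. S s)"
        unfolding down_def
      proof (intro ballI allI impI)
        fix x y assume "x \<in> (\<Union>s\<in>C. S s)" and yx: "(y, x) \<in> r"
        then obtain s where s: "s \<in> C" "x \<in> S s" by blast
        then have "y \<in> S s" using S[OF s(1)] yx unfolding down_def by blast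
        then show "y \<in> (\<Union>s\<in>C. S s)" using s(1) by blast
      qed
      moreover have "(\<Union>s\<in>C. S s) \<subseteq> ?H" using S by fastforce
      moreover have "?H \<subseteq> generated (\<Union>s\<in>C. S s)"
      proof
        fix x assume "x \<in> ?H"
        then obtain s where s: "s \<in> C" "x \<in> fst s" by force
        then have "x \<in> generated (S s)" using S by blast
        moreover have "generated (S s) \<subseteq> generated (\<Union>s\<in>C. S s)"
          using s by (intro generated_mono) blast
        ultimately show "x \<in> generated (\<Union>s\<in>C. S s)" by blast
      qed
      ultimately show ?thesis unfolding sandwich_def by blast
    qed
    ultimately have "(?H, F, ?E) \<in> A" by (simp add: A_def F_def)
    moreover have "P s (?H, F, ?E)" if "s \<in> C" for s
    proof -
      obtain H f E where s: "s = (H, f, E)" by (metis prod_cases3)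
      with that have C: "(H, f, E) \<in> C" by simp
      then have "H \<subseteq> ?H" "E \<subseteq> ?E" by blast+
      then show ?thesis using agree[OF C] by (simp add: P_def s)
    qed
    ultimately show "\<exists>u\<in>A. \<forall>a\<in>C. P a u" by blast
  qed
  then obtain H f E where m: "(H, f, E) \<in> A" "\<And>s. s \<in> A \<Longrightarrow> P (H, f, E) s \<Longrightarrow> s = (H, f, E)"
    by (metis prod_cases3)
  have good: "good H f E" using m(1) by (simp add: A_def)
  have "H = UNIV"
  proof (rule ccontr)
    assume "H \<noteq> UNIV"
    then obtain x where x: "x \<notin> H" by auto
    obtain S where S: "down S" "S \<subseteq> H" "H \<subseteq> generated S"
      using m(1) by (auto simp: A_def sandwich_def)
    define S' where "S' = {y. (y, x) \<in> r}"
    \<comment> \<open>An element of \<open>S\<close> above \<open>x\<close> would put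
      \<open>x\<close> into the downward closed set \<open>S\<close>.\<close>
    have "S \<subseteq> S'"
    proof
      fix y assume "y \<in> S"
      then have "(x, y) \<notin> r" using S x by (auto simp: down_def)
      then show "y \<in> S'" using tot by (auto simp: S'_def)
    qed
    then have HK: "H \<subseteq> generated S'" using S(3) generated_mono by blast
    have "x \<in> S'" using tot[of x x] by (simp add: S'_def)
    then have xK: "x \<in> generated S'" using subset_generated by blast
    have "countable S'" using seg by (simp add: S'_def)
    then obtain f' E' where st: "good (generated S') f' E'" "\<And>x. x \<in> H \<Longrightarrow> f' x = f x" "E \<subseteq> E'"
      using good_step[OF good HK add_closed_generated countable_generated] by metis
    define f'' where "f'' y = (if y \<in> generated S' then f' y else 0)" for y
    \<comment> \<open>The union lemma for a one-element chain shows that changing the colouring off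
      its carrier preserves goodness.\<close>
    have "good (generated S') f'' E'"
      using good_Union_chain[of "{(generated S', f', E')}" f''] st(1) by (simp add: f''_def)
    moreover have "down S'" using tr by (auto simp: down_def S'_def dest: transD)
    ultimately have "(generated S', f'', E') \<in> A"
      using subset_generated by (auto simp: A_def sandwich_def f''_def)
    moreover have "P (H, f, E) (generated S', f'', E')"
      using HK st by (auto simp: P_def f''_def)
    ultimately have "generated S' = H" using m(2) by blast
    then show False using x xK by simp
  qed
  then show thesis using good that by blast
qed

theorem theorem3:
  assumes CH: "|UNIV :: real set| =o cardSuc natLeq"
  shows "\<exists>f :: real \<Rightarrow> nat. \<forall>x :: real.
    finite {h :: real. h > 0 \<and> f (x - h) = f (x + h)} \<and>
    card {h :: real. h > 0 \<and> f (x - h) = f (x + h)} \<le> 1"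
proof -
  define r where "r = |UNIV :: real set|"
  have r: "Card_order r" "Field r = UNIV"
    unfolding r_def by (rule card_of_Card_order, rule Field_card_of)
  then have wo: "Well_order r" by (metis card_order_on_well_order_on)
  have refl: "(x, x) \<in> r" for x
    using wo r(2) by (simp add: well_order_on_def linear_order_on_def partial_order_on_def
        preorder_on_def refl_on_def)
  have tot: "(x, y) \<in> r \<or> (y, x) \<in> r" for x y
    using wo r(2) refl by (cases "x = y") (auto simp: well_order_on_def linear_order_on_def total_on_def)
  have tr: "trans r"
    using wo by (simp add: well_order_on_def linear_order_on_def partial_order_on_def preorder_on_def)
  \<comment> \<open>Proper initial segments of a cardinal order are strictly smaller than the whole,
    and CH makes this mean countable.\<close>
  have seg: "countable {y. (y, x) \<in> r}" for x
  proof -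
    have "|underS r x| <o r" using r by (simp add: card_of_underS)
    then have "|underS r x| <o cardSuc natLeq" using CH ordLess_ordIso_trans r_def by blast
    then have "|underS r x| \<le>o natLeq"
      using cardSuc_ordLeq_ordLess[OF natLeq_Card_order card_of_Card_order] by blast
    then have "countable (underS r x)" by (simp add: countable_card_le_natLeq)
    moreover have "{y. (y, x) \<in> r} \<subseteq> insert x (underS r x)" by (auto simp: underS_def)
    ultimately show ?thesis by (meson countable_insert countable_subset)
  qed
  obtain f E where good: "good UNIV f E"
    using exists_good_UNIV[OF tot tr seg] by blast
  have "finite {h. h > 0 \<and> f (x - h) = f (x + h)} \<and> card {h. h > 0 \<and> f (x - h) = f (x + h)} \<le> 1" for x
  proof -
    let ?S = "{h. h > 0 \<and> f (x - h) = f (x + h)}"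
    \<comment> \<open>Both pairs have sum \<open>2 * x\<close>, so they share a point;
      \<open>x - h = x + k\<close> is impossible for positive \<open>h\<close> and
      \<open>k\<close>.\<close>
    have eq: "h = k" if "h \<in> ?S" "k \<in> ?S" for h k
      using good_pairs[OF good, of "x - h" "x + h" "x - k" "x + k"] that by auto
    then have sub: "?S \<subseteq> {h}" if "h \<in> ?S" for h using that by blast
    have "\<exists>h. ?S \<subseteq> {h}" using sub by blast
    then obtain h where "?S \<subseteq> {h}" by blast
    then show ?thesis
      using finite_subset[of ?S "{h}"] card_mono[of "{h}" ?S] by simp
  qed
  then show ?thesis by blast
qed

end
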